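(* Let $k\ge 3$ and $e\ge 3$. Suppose there exists a strongly equitable uniquely $(k-1)$-chromatic $e$-star system of order $n_{k-1}\equiv 0\pmod{2e}$ whose colour classes $C_1,\dots,C_{k-1}$ satisfy $|C_i|>e$ for $1\le i\le k-1$. Then there exists a strongly equitable $k$-chromatic $e$-star system of some order $n_k\equiv 0\pmod{2e}$.
   Context: An $e$-star is the complete bipartite graph $K_{1,e}$. An $e$-star system of order $n$ is a pair $(V,\mathcal B)$ where $|V|=n$ and $\mathcal B$ is a set of $e$-stars (subgraphs of the complete graph $K_n$ on $V$) whose edge sets partition the edge set of $K_n$. An $e$-star system is $k$-colourable if $V$ can be partitioned into $k$ sets (colour classes) such that no star in $\mathcal B$ has all its vertices in the same class; it is $k$-chromatic if it is $k$-colourable but not $(k-1)$-colourable. It is uniquely $k$-colourable if any two $k$-colourings differ only by a permutation of the colours. A colouring is strongly equitable if all colour classes have the same size. A strongly equitable (uniquely) $k$-chromatic system is a (uniquely colourable) $k$-chromatic system admitting a strongly equitable $k$-colouring. *)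

theory Defs
  imports "HOL-Number_Theory.Cong" "HOL-Library.Disjoint_Sets" "HOL-Library.FuncSet"
    "HOL-Combinatorics.Permutations"
begin

(* Edges are two-element vertex sets. A star with at least one edge has no isolated
   vertices, so it is identified with its edge set S; its vertex set is \<Union>S. *)

definition complete_edges :: "'a set \<Rightarrow> 'a set set" where
  "complete_edges V = {E. E \<subseteq> V \<and> card E = 2}"

definition is_star :: "nat \<Rightarrow> 'a set set \<Rightarrow> bool" where
  "is_star e S \<longleftrightarrow>
     (\<exists>c L. finite L \<and> card L = e \<and> c \<notin> L \<and> S = (\<lambda>x. {c, x}) ` L)"

definition star_system :: "nat \<Rightarrow> nat \<Rightarrow> 'a set \<Rightarrow> 'a set set set \<Rightarrow> bool" where
  "star_system e n V B \<longleftrightarrow>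
     finite V \<and> card V = n \<and> (\<forall>S\<in>B. is_star e S) \<and> partition_on (complete_edges V) B"

definition colour_class :: "'a set \<Rightarrow> ('a \<Rightarrow> nat) \<Rightarrow> nat \<Rightarrow> 'a set" where
  "colour_class V f i = {v \<in> V. f v = i}"

(* Colour classes may be empty here. A k-colouring of a k-chromatic system uses all k
   colours, so this does not affect which systems are (uniquely) k-chromatic for k > 0. *)
definition is_colouring :: "nat \<Rightarrow> 'a set \<Rightarrow> 'a set set set \<Rightarrow> ('a \<Rightarrow> nat) \<Rightarrow> bool" where
  "is_colouring k V B f \<longleftrightarrow>
     f \<in> V \<rightarrow> {1..k} \<and> (\<forall>S\<in>B. \<not> (\<exists>i\<in>{1..k}. \<Union>S \<subseteq> colour_class V f i))"

definition colourable :: "nat \<Rightarrow> 'a set \<Rightarrow> 'a set set set \<Rightarrow> bool" where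
  "colourable k V B \<longleftrightarrow> (\<exists>f. is_colouring k V B f)"

(* Meaningful for k > 0 only, because of truncated subtraction. *)
definition chromatic :: "nat \<Rightarrow> 'a set \<Rightarrow> 'a set set set \<Rightarrow> bool" where
  "chromatic k V B \<longleftrightarrow> colourable k V B \<and> \<not> colourable (k - 1) V B"

definition uniquely_colourable :: "nat \<Rightarrow> 'a set \<Rightarrow> 'a set set set \<Rightarrow> bool" where
  "uniquely_colourable k V B \<longleftrightarrow> colourable k V B \<and>
     (\<forall>f g. is_colouring k V B f \<longrightarrow> is_colouring k V B g \<longrightarrow>
        (\<exists>p. p permutes {1..k} \<and> (\<forall>v\<in>V. g v = p (f v))))"

definition strongly_equitable :: "nat \<Rightarrow> 'a set \<Rightarrow> ('a \<Rightarrow> nat) \<Rightarrow> bool" where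
  "strongly_equitable k V f \<longleftrightarrow>
     (\<forall>i\<in>{1..k}. \<forall>j\<in>{1..k}. card (colour_class V f i) = card (colour_class V f j))"

end

theory Submission
  imports Defs
begin

text \<open>Take \<open>k\<close> copies of \<open>V\<close>, colour copy \<open>0\<close> entirely with the new colour \<open>k\<close> and
  the other \<open>k - 1\<close> copies by \<open>C\<close>; all colour classes then have size \<open>card V\<close>. Think of
  a star system as an orientation of the complete graph (from centre to leaf) together with a
  grouping of every out-neighbourhood into \<open>e\<close>-sets. Inside each copy use the orientation coming
  from \<open>B\<close>, between copies orient from the lower index to the higher one. On the copies of positive
  index the stars of \<open>B\<close> are kept. All other out-neighbours can be grouped so that no star is
  monochromatic, since sufficiently many of them have a colour other than that of the centre. At a
  centre in copy \<open>0\<close> there is in addition room for \<open>k - 1\<close> stars, the leaves of the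
  \<open>a\<close>-th lying in the \<open>a\<close>-th colour class of copy \<open>1\<close>. A
  \<open>(k - 1)\<close>-colouring would restrict to \<open>C\<close> up to a permutation on copy \<open>1\<close>, so one of these
  stars would be monochromatic.\<close>

section \<open>Star systems as orientations with grouped out-neighbourhoods\<close>

definition star_of :: "'a \<Rightarrow> 'a set \<Rightarrow> 'a set set" where
  "star_of c L = (\<lambda>x. {c, x}) ` L"

definition stars :: "'a set \<Rightarrow> ('a \<Rightarrow> 'a set set) \<Rightarrow> 'a set set set" where
  "stars V P = {star_of v L | v L. v \<in> V \<and> L \<in> P v}"

text \<open>\<open>P v\<close> is the family of leaf sets of the stars with centre \<open>v\<close>.\<close>

definition star_orientation :: "nat \<Rightarrow> 'a set \<Rightarrow> ('a \<Rightarrow> 'a set set) \<Rightarrow> bool" where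
  "star_orientation e V P \<longleftrightarrow>
     (\<forall>v\<in>V. disjoint (P v) \<and> (\<forall>L\<in>P v. card L = e \<and> L \<subseteq> V - {v})) \<and>
     (\<forall>u\<in>V. \<forall>v\<in>V. u \<noteq> v \<longrightarrow> (u \<in> \<Union>(P v)) \<noteq> (v \<in> \<Union>(P u)))"

text \<open>An edge \<open>{u, v}\<close> is directed one way only, which determines the centre of
  any star through it; disjointness of \<open>P\<close> at that centre then determines the leaf set.
  The condition \<open>e > 0\<close> keeps every star nonempty, as a partition demands.\<close>

lemma star_system_stars:
  assumes "finite V" "e > 0" and P: "star_orientation e V P"
  shows "star_system e (card V) V (stars V P)"
proof -
  have P1: "disjoint (P v)" "card L = e" "L \<subseteq> V - {v}" if "v \<in> V" "L \<in> P v" for v L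
    using P that by (auto simp: star_orientation_def)
  have P2: "(u \<in> \<Union>(P v)) \<noteq> (v \<in> \<Union>(P u))" if "u \<in> V" "v \<in> V" "u \<noteq> v" for u v
    using P that unfolding star_orientation_def by blast
  have "is_star e S" if S: "S \<in> stars V P" for S
  proof -
    obtain v L where "v \<in> V" "L \<in> P v" "S = star_of v L"
      using S unfolding stars_def by blast
    then show ?thesis
      unfolding is_star_def star_of_def using P1[of v L] \<open>finite V\<close>
      by (metis Diff_iff finite_subset finite_Diff insertI1 subsetD)
  qed
  moreover have "partition_on (complete_edges V) (stars V P)"
  proof (rule partition_onI)
    show "\<Union>(stars V P) = complete_edges V"
    proof (intro equalityI subsetI)
      fix E assume "E \<in> \<Union>(stars V P)"
      then obtain v L x where "v \<in> V" "L \<in> P v" "x \<in> L" "E = {v, x}"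
        by (auto simp: stars_def star_of_def)
      moreover from this have "x \<in> V" "x \<noteq> v"
        using P1(3)[of v L] by auto
      ultimately show "E \<in> complete_edges V"
        by (auto simp: complete_edges_def)
    next
      fix E assume "E \<in> complete_edges V"
      then obtain u v where uv: "E = {u, v}" "u \<noteq> v" "u \<in> V" "v \<in> V"
        by (auto simp: complete_edges_def card_2_iff)
      have "\<exists>c x. c \<in> V \<and> E = {c, x} \<and> x \<in> \<Union>(P c)"
        using P2[of u v] uv by (metis insert_commute)
      then show "E \<in> \<Union>(stars V P)"
        unfolding stars_def star_of_def by blast
    qed
  next
    fix S T assume ST: "S \<in> stars V P" "T \<in> stars V P" "S \<noteq> T"
    then obtain v L w M where v: "v \<in> V" "L \<in> P v" "S = star_of v L"
      and w: "w \<in> V" "M \<in> P w" "T = star_of w M"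
      unfolding stars_def by blast
    show "disjnt S T"
    proof (rule ccontr)
      assume "\<not> disjnt S T"
      then obtain x y where x: "x \<in> L" and y: "y \<in> M" and eq: "{v, x} = {w, y}"
        using v w by (auto simp: disjnt_iff star_of_def)
      show False
      proof (cases "v = w")
        case True
        then have "x = y" using eq by (auto simp: doubleton_eq_iff)
        then have "L = M"
          using P1(1)[OF v(1,2)] x y v w True by (auto simp: disjoint_def)
        then show False using True v w ST by simp
      next
        case False
        then have "w = x" "v = y" using eq by (auto simp: doubleton_eq_iff)
        then show False using P2[of v w] False v w x y by auto
      qed
    qed
  next
    show "{} \<notin> stars V P"
    proof
      assume "{} \<in> stars V P"
      then obtain v where "v \<in> V" "{} \<in> P v"
        unfolding stars_def star_of_def by auto
      then show False using P1(2)[of v "{}"] \<open>e > 0\<close> by simp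
    qed
  qed
  ultimately show ?thesis
    using \<open>finite V\<close> by (simp add: star_system_def)
qed

text \<open>A centre and a leaf set are chosen for every star, which also settles the ambiguity of
  the centre when \<open>e = 1\<close>. Each edge is directed away from the chosen centre of the
  unique star containing it, so it gets exactly one direction.\<close>

lemma star_system_orientation:
  assumes "star_system e n V B"
  obtains P where "star_orientation e V P" "B = stars V P"
proof -
  have star: "\<exists>c L. card L = e \<and> c \<notin> L \<and> S = star_of c L" if "S \<in> B" for S
    using assms that by (fastforce simp: star_system_def is_star_def star_of_def)
  have part: "partition_on (complete_edges V) B"
    using assms by (simp add: star_system_def)
  then have ne: "{} \<notin> B" and un: "\<Union>B = complete_edges V"
    by (auto simp: partition_on_def)
  obtain cen lv where cl: "card (lv S) = e" "cen S \<notin> lv S" "S = star_of (cen S) (lv S)"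
    if "S \<in> B" for S
    using star by metis
  have uniq: "S = T" if "S \<in> B" "T \<in> B" "E \<in> S" "E \<in> T" for S T E
    using part that unfolding partition_on_def disjoint_def by blast
  have mem: "E \<in> S \<longleftrightarrow> (\<exists>x\<in>lv S. E = {cen S, x})" if "S \<in> B" for S E
    using cl(3)[OF that] by (auto simp: star_of_def)
  have inV: "cen S \<in> V" "lv S \<subseteq> V" if "S \<in> B" for S
  proof -
    have "{cen S, x} \<subseteq> V" if x: "x \<in> lv S" for x
    proof -
      have "{cen S, x} \<in> \<Union>B" using mem \<open>S \<in> B\<close> x by blast
      then show ?thesis by (simp add: un complete_edges_def)
    qed
    \<comment> \<open>The centre is known to lie in \<open>V\<close> only through an edge of the
      star, so a leaf is required.\<close>
    moreover have "lv S \<noteq> {}"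
      using ne that cl(3)[OF that] by (auto simp: star_of_def)
    ultimately show "cen S \<in> V" "lv S \<subseteq> V" by auto
  qed
  define P where "P = (\<lambda>v. lv ` {S \<in> B. cen S = v})"
  have "star_orientation e V P"
    unfolding star_orientation_def
  proof (intro conjI ballI impI)
    fix v assume "v \<in> V"
    show "disjoint (P v)"
      unfolding disjoint_def
    proof (intro ballI impI)
      fix L M assume "L \<in> P v" "M \<in> P v" "L \<noteq> M"
      then obtain S T where ST: "S \<in> B" "cen S = v" "L = lv S" "T \<in> B" "cen T = v" "M = lv T"
        by (auto simp: P_def)
      have "S = T" if "x \<in> L" "x \<in> M" for x
      proof (rule uniq)
        show "{v, x} \<in> S" "{v, x} \<in> T" using mem ST that by metis+
      qed (use ST in auto)
      then show "L \<inter> M = {}" using ST(3,6) \<open>L \<noteq> M\<close> by blast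
    qed
    fix L assume "L \<in> P v"
    then show "card L = e" "L \<subseteq> V - {v}"
      using cl(1,2) inV(2) by (auto simp: P_def)
  next
    fix u v assume uv: "u \<in> V" "v \<in> V" "u \<noteq> v"
    then have "{u, v} \<in> \<Union>B"
      by (auto simp: un complete_edges_def)
    then obtain S where S: "S \<in> B" "{u, v} \<in> S" by blast
    \<comment> \<open>Any star whose chosen centre and leaf give the edge \<open>{x, y}\<close> must
      be \<open>S\<close> itself, so the direction of this edge is read off from
      \<open>cen S\<close>.\<close>
    have arc: "(y \<in> \<Union>(P x)) = (cen S = x)" if xy: "{x, y} \<in> S" "x \<noteq> y" for x y
    proof
      assume "y \<in> \<Union>(P x)"
      then obtain T where T: "T \<in> B" "cen T = x" "y \<in> lv T" by (auto simp: P_def)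
      then have "{x, y} \<in> T" using mem by blast
      then show "cen S = x" using uniq[OF S(1) T(1) xy(1)] T by simp
    next
      assume x: "cen S = x"
      obtain z where "z \<in> lv S" "{x, y} = {cen S, z}" using mem[OF S(1)] xy by blast
      then have "y \<in> lv S" using x xy by (auto simp: doubleton_eq_iff)
      then show "y \<in> \<Union>(P x)" using S x by (auto simp: P_def)
    qed
    have "cen S = u \<or> cen S = v"
      using mem[OF S(1)] S(2) by (auto simp: doubleton_eq_iff)
    then show "(u \<in> \<Union>(P v)) \<noteq> (v \<in> \<Union>(P u))"
      using arc[of u v] arc[of v u] S uv by (auto simp: insert_commute)
  qed
  moreover have "B = stars V P"
  proof (intro equalityI subsetI)
    fix S assume "S \<in> B"
    then have "cen S \<in> V" "lv S \<in> P (cen S)" "S = star_of (cen S) (lv S)"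
      using cl(3)[of S] inV(1) by (auto simp: P_def)
    then show "S \<in> stars V P" unfolding stars_def by blast
  next
    fix S assume "S \<in> stars V P"
    then obtain T where "T \<in> B" "S = star_of (cen T) (lv T)"
      by (auto simp: stars_def P_def)
    then show "S \<in> B" using cl(3)[of T] by metis
  qed
  ultimately show ?thesis using that by blast
qed

text \<open>A star with at least one leaf has vertex set \<open>insert v L\<close>; if it lies in a
  single colour class, that class is the one of its centre.\<close>

lemma is_colouring_stars:
  assumes "\<And>v L. v \<in> V \<Longrightarrow> L \<in> P v \<Longrightarrow> L \<subseteq> V \<and> L \<noteq> {}"
  shows "is_colouring k V (stars V P) f \<longleftrightarrow>
     f \<in> V \<rightarrow> {1..k} \<and> (\<forall>v\<in>V. \<forall>L\<in>P v. \<exists>u\<in>L. f u \<noteq> f v)"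
proof -
  have mono: "(\<exists>i\<in>{1..k}. \<Union>(star_of v L) \<subseteq> colour_class V f i) \<longleftrightarrow> (\<forall>u\<in>L. f u = f v)"
    if f: "f \<in> V \<rightarrow> {1..k}" and v: "v \<in> V" "L \<in> P v" for v L
  proof -
    have "\<Union>(star_of v L) = insert v L" "L \<subseteq> V"
      using assms[OF v] by (auto simp: star_of_def)
    then show ?thesis using f v by (auto simp: colour_class_def)
  qed
  have "(\<forall>S\<in>stars V P. \<not> (\<exists>i\<in>{1..k}. \<Union>S \<subseteq> colour_class V f i)) \<longleftrightarrow>
      (\<forall>v\<in>V. \<forall>L\<in>P v. \<not> (\<exists>i\<in>{1..k}. \<Union>(star_of v L) \<subseteq> colour_class V f i))"
    unfolding stars_def by auto
  also have "\<dots> \<longleftrightarrow> (\<forall>v\<in>V. \<forall>L\<in>P v. \<exists>u\<in>L. f u \<noteq> f v)" if "f \<in> V \<rightarrow> {1..k}"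
    by (intro ball_cong refl) (simp only: mono[OF that] bex_simps ball_simps)
  finally show ?thesis
    unfolding is_colouring_def by blast
qed

section \<open>Partitions into sets of size e that all meet a given subset\<close>

text \<open>Induction on the number \<open>m\<close> of blocks: reserve one point of
  \<open>A\<close> per block, and form the first block from one reserved point and
  \<open>e - 1\<close> unreserved ones. The other reserved points are left for the remaining
  blocks.\<close>

lemma partition_on_card_meeting:
  assumes "finite X" "card X = e * m" "A \<subseteq> X" "m \<le> card A" "e > 0"
  shows "\<exists>P. partition_on X P \<and> (\<forall>L\<in>P. card L = e \<and> L \<inter> A \<noteq> {})"
  using assms(1-4)
proof (induction m arbitrary: X A)
  case 0
  then show ?case by (auto simp: partition_on_empty)
next
  case (Suc m)
  obtain A0 where A0: "A0 \<subseteq> A" "card A0 = Suc m"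
    using obtain_subset_with_card_n[OF Suc.prems(4)] by metis
  then have A0X: "A0 \<subseteq> X" using Suc.prems(3) by simp
  then have finA0: "finite A0" using Suc.prems(1) by (rule finite_subset)
  obtain a where a: "a \<in> A0" using A0 by fastforce
  \<comment> \<open>The factor \<open>1\<close> brings the difference into the shape of
    \<open>diff_mult_distrib\<close>. There are \<open>(e - 1) * Suc m\<close> unreserved points,
    enough to fill up one block.\<close>
  have "card (X - A0) = e * Suc m - 1 * Suc m"
    using Suc.prems A0 A0X finA0 by (simp add: card_Diff_subset)
  also have "\<dots> = (e - 1) * Suc m" by (rule diff_mult_distrib[symmetric])
  finally have "e - 1 \<le> card (X - A0)" by simp
  then obtain T where T: "T \<subseteq> X - A0" "card T = e - 1" "finite T"
    by (rule obtain_subset_with_card_n)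
  define L where "L = insert a T"
  have L: "card L = e" "L \<subseteq> X" "finite L" "a \<in> L"
    using T a A0X \<open>e > 0\<close> by (auto simp: L_def card_insert_if)
  have "card (X - L) = e * m"
    using L Suc.prems by (simp add: card_Diff_subset)
  moreover have "A0 - {a} \<subseteq> X - L" using T A0X by (auto simp: L_def)
  moreover have "m \<le> card (A0 - {a})" using A0 a by simp
  ultimately obtain P where P: "partition_on (X - L) P" "\<forall>M\<in>P. card M = e \<and> M \<inter> (A0 - {a}) \<noteq> {}"
    using Suc.IH[of "X - L" "A0 - {a}"] Suc.prems by auto
  have "partition_on X (insert L P)"
    using P(1) L by (subst partition_on_insert) (auto simp: partition_on_def disjnt_def)
  moreover have "\<forall>M\<in>insert L P. card M = e \<and> M \<inter> A \<noteq> {}"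
    using P(2) L a A0 by blast
  ultimately show ?case by blast
qed

lemma card_Union_equicardinal:
  assumes "disjoint P" "\<And>L. L \<in> P \<Longrightarrow> card L = e" "finite (\<Union>P)"
  shows "e dvd card (\<Union>P)"
proof -
  have "card (\<Union>P) = sum card P"
    using assms(1,3) by (intro card_Union_disjoint)
      (auto intro: finite_subset[OF Union_upper] simp: pairwise_def disjoint_def disjnt_def)
  also have "\<dots> = e * card P" using assms(2) by simp
  finally show ?thesis by simp
qed

text \<open>The blocks of \<open>D\<close> are prescribed and lie inside \<open>A\<close>. Outside
  them \<open>(card X - card (\<Union>D)) / e\<close> blocks remain to be formed, and the inequality
  says that \<open>A - \<Union>D\<close> has a point for each.\<close>

lemma partition_on_card_meeting_extend:
  assumes X: "finite X" "e dvd card X" "A \<subseteq> X" "e > 0"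
    and D: "disjoint D" "\<And>L. L \<in> D \<Longrightarrow> L \<subseteq> A \<and> card L = e"
    and le: "card X \<le> e * card (A - \<Union>D) + card (\<Union>D)"
  shows "\<exists>P. D \<subseteq> P \<and> partition_on X P \<and> (\<forall>L\<in>P. card L = e \<and> L \<inter> A \<noteq> {})"
proof -
  have "\<Union>D \<subseteq> A" using D(2) by blast
  then have U: "\<Union>D \<subseteq> X" "finite (\<Union>D)"
    using X(1,3) by (auto intro: finite_subset)
  have "{} \<notin> D" using D(2)[of "{}"] \<open>e > 0\<close> by auto
  have diff: "card (X - \<Union>D) = card X - card (\<Union>D)"
    using U by (simp add: card_Diff_subset)
  moreover have "e dvd card (\<Union>D)"
    using D U by (intro card_Union_equicardinal) auto
  ultimately obtain m where m: "card (X - \<Union>D) = e * m"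
    using X(2) by (metis dvd_diff_nat dvdE)
  then have "e * m \<le> e * card (A - \<Union>D)"
    using le diff by linarith
  then have "m \<le> card (A - \<Union>D)" using \<open>e > 0\<close> by simp
  then obtain P where P: "partition_on (X - \<Union>D) P" "\<forall>L\<in>P. card L = e \<and> L \<inter> (A - \<Union>D) \<noteq> {}"
    using partition_on_card_meeting[of "X - \<Union>D" e m "A - \<Union>D"] X m by blast
  have "partition_on X (D \<union> P)"
  proof (rule partition_onI)
    show "\<Union>(D \<union> P) = X" using partition_onD1[OF P(1)] U by blast
    show "{} \<notin> D \<union> P" using partition_onD3[OF P(1)] \<open>{} \<notin> D\<close> by blast
    have "disjoint (D \<union> P)"
      using D(1) partition_onD2[OF P(1)] partition_onD1[OF P(1)] by (intro disjoint_union) auto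
    then show "disjnt p q" if "p \<in> D \<union> P" "q \<in> D \<union> P" "p \<noteq> q" for p q
      using that by (metis disjnt_def disjointD)
  qed
  moreover have "card L = e \<and> L \<inter> A \<noteq> {}" if L: "L \<in> D \<union> P" for L
  proof (cases "L \<in> D")
    case True
    then show ?thesis using D(2)[OF True] \<open>{} \<notin> D\<close> by (metis Int_absorb2)
  next
    case False
    then show ?thesis using L P(2) by blast
  qed
  ultimately show ?thesis by (metis Un_upper1)
qed

section \<open>Transport along injective maps\<close>

lemma complete_edges_image:
  assumes "inj_on h V"
  shows "complete_edges (h ` V) = image h ` complete_edges V"
proof (intro equalityI subsetI)
  fix E assume "E \<in> complete_edges (h ` V)"
  then obtain F where "F \<subseteq> V" "E = h ` F" "card E = 2"
    by (auto simp: complete_edges_def subset_image_iff)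
  then show "E \<in> image h ` complete_edges V"
    using card_image[OF inj_on_subset[OF assms, of F]] by (auto simp: complete_edges_def)
next
  fix E assume "E \<in> image h ` complete_edges V"
  then show "E \<in> complete_edges (h ` V)"
    using card_image[OF inj_on_subset[OF assms]] by (auto simp: complete_edges_def)
qed

text \<open>Injectivity of \<open>h\<close> keeps the leaves of a star distinct from each other and
  from the centre. It also makes \<open>image h\<close> injective on edges, so disjoint stars stay
  disjoint.\<close>

lemma star_system_image:
  assumes h: "inj_on h V" and sys: "star_system e n V B"
  shows "star_system e n (h ` V) (image (image h) ` B)"
proof -
  obtain P where P: "star_orientation e V P" "B = stars V P"
    using star_system_orientation[OF sys] .
  have fin: "finite V" "card V = n" and part: "partition_on (complete_edges V) B"
    using sys by (auto simp: star_system_def)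
  have "is_star e (image h ` S)" if S: "S \<in> B" for S
  proof -
    obtain v L where vL: "v \<in> V" "L \<in> P v" "S = star_of v L"
      using S unfolding P(2) stars_def by blast
    then have L: "L \<subseteq> V - {v}" "card L = e"
      using P by (auto simp: star_orientation_def)
    have "image h ` S = (\<lambda>x. {h v, x}) ` (h ` L)"
      by (simp add: vL star_of_def image_image)
    moreover have "card (h ` L) = e"
      using card_image[OF inj_on_subset[OF h, of L]] L by auto
    moreover have "h v \<notin> h ` L" using L vL h by (auto simp: inj_on_def)
    moreover have "finite (h ` L)" using L fin by (auto intro: finite_subset)
    ultimately show ?thesis unfolding is_star_def by blast
  qed
  moreover have "inj_on (image h) (complete_edges V)"
    by (rule inj_on_subset[OF inj_on_image_Pow[OF h]]) (auto simp: complete_edges_def)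
  then have "partition_on (complete_edges (h ` V)) (image (image h) ` B)"
    using partition_on_inj_image[OF part, of "image h"] part
    by (simp add: complete_edges_image[OF h] partition_on_def image_iff)
  ultimately show ?thesis
    using fin h by (auto simp: star_system_def card_image)
qed

lemma is_colouring_image:
  assumes "inj_on h V" "star_system e n V B"
  shows "is_colouring k (h ` V) (image (image h) ` B) f \<longleftrightarrow> is_colouring k V B (f \<circ> h)"
proof -
  have "S \<subseteq> complete_edges V" if "S \<in> B" for S
    using assms(2) that by (auto simp: star_system_def partition_on_def)
  then have sub: "\<Union>S \<subseteq> V" if "S \<in> B" for S
    using that by (force simp: complete_edges_def)
  have "\<Union>(image h ` S) \<subseteq> colour_class (h ` V) f i \<longleftrightarrow> \<Union>S \<subseteq> colour_class V (f \<circ> h) i"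
    if "S \<in> B" for S i
    using sub[OF that] by (fastforce simp: colour_class_def)
  then show ?thesis
    by (auto simp: is_colouring_def)
qed

lemma is_colouring_cong:
  assumes "\<And>v. v \<in> V \<Longrightarrow> f v = g v"
  shows "is_colouring k V B f \<longleftrightarrow> is_colouring k V B g"
proof -
  have "colour_class V f = colour_class V g"
    using assms by (auto simp: colour_class_def fun_eq_iff)
  then show ?thesis using assms by (simp add: is_colouring_def Pi_iff)
qed

lemma colouring_inv_into_comp:
  assumes "inj_on h V"
  shows "is_colouring k V B ((f \<circ> inv_into V h) \<circ> h) \<longleftrightarrow> is_colouring k V B f"
  by (rule is_colouring_cong) (simp add: assms)

lemma colourable_image:
  assumes "inj_on h V" "star_system e n V B"
  shows "colourable k (h ` V) (image (image h) ` B) \<longleftrightarrow> colourable k V B"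
  unfolding colourable_def is_colouring_image[OF assms]
  by (metis colouring_inv_into_comp[OF assms(1)])

lemma strongly_equitable_image:
  assumes h: "inj_on h V" and "strongly_equitable k V f"
  shows "strongly_equitable k (h ` V) (f \<circ> inv_into V h)"
proof -
  have "colour_class (h ` V) (f \<circ> inv_into V h) i = h ` colour_class V f i" for i
    using h by (auto simp: colour_class_def)
  moreover have "card (h ` colour_class V f i) = card (colour_class V f i)" for i
    by (intro card_image inj_on_subset[OF h]) (auto simp: colour_class_def)
  ultimately show ?thesis using assms(2) unfolding strongly_equitable_def by metis
qed

section \<open>The construction on k copies of V\<close>

theorem theorem4p3:
  fixes k e n :: nat and V :: "'a set" and B :: "'a set set set" and C :: "'a \<Rightarrow> nat"
  assumes "k \<ge> 3" and "e \<ge> 3"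
    and "star_system e n V B"
    and "[n = 0] (mod (2 * e))"
    and "chromatic (k - 1) V B"
    and "uniquely_colourable (k - 1) V B"
    and "is_colouring (k - 1) V B C"
    and "strongly_equitable (k - 1) V C"
    and "\<forall>i\<in>{1..k - 1}. card (colour_class V C i) > e"
  shows "\<exists>(n' :: nat) (V' :: nat set) (B' :: nat set set set) C'.
           star_system e n' V' B' \<and> [n' = 0] (mod (2 * e)) \<and>
           chromatic k V' B' \<and>
           is_colouring k V' B' C' \<and> strongly_equitable k V' C'"
proof -
  have "e > 0" using assms(2) by simp
  have fin: "finite V" and n: "card V = n"
    using assms(3) by (auto simp: star_system_def)
  have "e dvd n" using assms(4) by (metis cong_0_iff dvd_mult_right)
  obtain Q where Q: "star_orientation e V Q" and B: "B = stars V Q"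
    using star_system_orientation[OF assms(3)] .
  have Qv: "disjoint (Q v)" if "v \<in> V" for v
    using Q that by (auto simp: star_orientation_def)
  have QL: "card L = e" "L \<subseteq> V - {v}" if "v \<in> V" "L \<in> Q v" for v L
    using Q that by (auto simp: star_orientation_def)
  have Q2: "(u \<in> \<Union>(Q v)) \<noteq> (v \<in> \<Union>(Q u))" if "u \<in> V" "v \<in> V" "u \<noteq> v" for u v
    using Q that unfolding star_orientation_def by blast
  have colB: "is_colouring j V B f \<longleftrightarrow>
      f \<in> V \<rightarrow> {1..j} \<and> (\<forall>v\<in>V. \<forall>L\<in>Q v. \<exists>u\<in>L. f u \<noteq> f v)" for j f
    unfolding B
  proof (rule is_colouring_stars)
    fix v L assume "v \<in> V" "L \<in> Q v"
    then show "L \<subseteq> V \<and> L \<noteq> {}" using QL[of v L] \<open>e > 0\<close> by auto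
  qed
  have "C \<in> V \<rightarrow> {1..k - 1}" and CQ: "\<And>v L. v \<in> V \<Longrightarrow> L \<in> Q v \<Longrightarrow> \<exists>u\<in>L. C u \<noteq> C v"
    using assms(7) unfolding colB by simp_all
  have Crange: "1 \<le> C v" "C v < k" if "v \<in> V" for v
  proof -
    have "C v \<in> {1..k - 1}" using \<open>C \<in> V \<rightarrow> {1..k - 1}\<close> that by (rule Pi_mem)
    then show "1 \<le> C v" "C v < k" using assms(1) by auto
  qed
  define c where "c = card (colour_class V C 1)"
  have c: "card (colour_class V C a) = c" if "a \<in> {1..k - 1}" for a
  proof -
    have "1 \<in> {1..k - 1}" using assms(1) by simp
    then show ?thesis using assms(8) that unfolding strongly_equitable_def c_def by blast
  qed
  have nc: "n = (k - 1) * c"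
  proof -
    have "V = (\<Union>a\<in>{1..k - 1}. colour_class V C a)"
    proof (intro equalityI subsetI)
      fix v assume "v \<in> V"
      moreover from this have "C v \<in> {1..k - 1}" using Crange[of v] by simp
      ultimately show "v \<in> (\<Union>a\<in>{1..k - 1}. colour_class V C a)"
        by (simp add: colour_class_def)
    qed (auto simp: colour_class_def)
    then have "card V = card (\<Union>a\<in>{1..k - 1}. colour_class V C a)" by simp
    also have "\<dots> = (\<Sum>a\<in>{1..k - 1}. card (colour_class V C a))"
      using fin by (intro card_UN_disjoint) (auto simp: colour_class_def)
    finally show ?thesis using c n by simp
  qed
  \<comment> \<open>With at least two classes of equal size, a class fills at most half of
    \<open>V\<close>. This bounds from below the number of vertices whose colour differs from that
    of a given centre.\<close>
  have k2: "2 \<le> k - 1" using assms(1) by simp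
  then have "2 * c \<le> n" unfolding nc by (rule mult_le_mono1)
  have "c > e" using assms(1,9) by (simp add: c_def)

  \<comment> \<open>Leaf sets for centres in copy 0\<close>
  have "\<exists>T. T \<subseteq> colour_class V C a \<and> card T = e" if "a \<in> {1..k - 1}" for a
    using c[OF that] \<open>c > e\<close> by (metis less_imp_le_nat obtain_subset_with_card_n)
  then obtain T where T: "T a \<subseteq> colour_class V C a" "card (T a) = e" if "a \<in> {1..k - 1}" for a
    by metis
  have TC: "u \<in> V \<and> C u = a" if "u \<in> T a" "a \<in> {1..k - 1}" for u a
    using T(1)[OF that(2)] that(1) by (auto simp: colour_class_def)
  \<comment> \<open>These are the \<open>k - 1\<close> leaf sets in copy \<open>1\<close> that will
    rule out a \<open>(k - 1)\<close>-colouring. Every centre in copy \<open>0\<close> receives the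
    same family.\<close>
  define D where "D = (\<lambda>a. T a \<times> {1::nat}) ` {1..k - 1}"

  \<comment> \<open>Copy \<open>0\<close> will carry colour \<open>k\<close> alone, so a star
    centred there is not monochromatic once it has a leaf in a copy of positive index.\<close>
  have "\<exists>P. D \<subseteq> P \<and> partition_on (\<Union>(Q v) \<times> {0} \<union> V \<times> {0<..<k}) P \<and>
      (\<forall>L\<in>P. card L = e \<and> L \<inter> V \<times> {0<..<k} \<noteq> {})" if v: "v \<in> V" for v
  proof (rule partition_on_card_meeting_extend)
    have O: "\<Union>(Q v) \<subseteq> V" using QL(2)[OF v] by blast
    then have finO: "finite (\<Union>(Q v))" using fin finite_subset by blast
    have cardX: "card (\<Union>(Q v) \<times> {0} \<union> V \<times> {0<..<k}) = card (\<Union>(Q v)) + n * (k - 1)"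
      using fin finO n by (subst card_Un_disjoint) (auto simp: card_cartesian_product)
    have "e dvd card (\<Union>(Q v))"
      using Qv[OF v] QL(1)[OF v] finO by (rule card_Union_equicardinal)
    then show "e dvd card (\<Union>(Q v) \<times> {0} \<union> V \<times> {0<..<k})"
      using \<open>e dvd n\<close> by (simp add: cardX)
    show "finite (\<Union>(Q v) \<times> {0} \<union> V \<times> {0<..<k})" using fin finO by simp
    show "disjoint D"
      unfolding D_def
    proof (intro disjoint_family_on_disjoint_image, unfold disjoint_family_on_def, intro ballI impI)
      fix a b assume "a \<in> {1..k - 1}" "b \<in> {1..k - 1}" "a \<noteq> b"
      then show "T a \<times> {1} \<inter> T b \<times> {1} = {}" using TC[of _ a] TC[of _ b] by blast
    qed
    show "L \<subseteq> V \<times> {0<..<k} \<and> card L = e" if L: "L \<in> D" for L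
    proof -
      obtain a where a: "a \<in> {1..k - 1}" "L = T a \<times> {1}" using L unfolding D_def by blast
      then have "T a \<subseteq> V" "(1::nat) \<in> {0<..<k}" using TC[of _ a] assms(1) by auto
      then show ?thesis using a T(2)[OF a(1)] by (auto simp: card_cartesian_product)
    qed
    have DV: "\<Union>D \<subseteq> V \<times> {1}"
      using TC by (auto simp: D_def)
    then have cardD: "card (\<Union>D) \<le> n"
      using card_mono[OF _ DV] fin n by (simp add: card_cartesian_product)
    \<comment> \<open>Put \<open>d = card (\<Union>D)\<close>, so \<open>d \<le> n\<close>. Since
      \<open>e \<ge> 3\<close>, the right-hand side is at least \<open>3 * (N - d) + d\<close>,
      hence at least \<open>3 * N - 2 * n\<close>. The left-hand side is at most
      \<open>n + N\<close>, and \<open>N \<ge> 2 * n\<close> closes the gap.\<close>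
    define N where "N = n * (k - 1)"
    have "\<Union>D \<subseteq> V \<times> {0<..<k}" using DV assms(1) by auto
    then have "card (V \<times> {0<..<k} - \<Union>D) + card (\<Union>D) = card (V \<times> {0<..<k})"
      using card_Un_disjoint[of "V \<times> {0<..<k} - \<Union>D" "\<Union>D"] finite_subset[OF DV] fin
      by (simp add: Un_absorb2 Diff_disjoint Int_commute)
    also have "\<dots> = N" using n by (simp add: N_def card_cartesian_product)
    finally have "card (V \<times> {0<..<k} - \<Union>D) + card (\<Union>D) = N" .
    moreover have "2 * n \<le> N" using mult_le_mono2[OF k2, of n] by (simp add: N_def)
    moreover have "card (\<Union>(Q v)) \<le> n" using card_mono[OF fin O] n by simp
    moreover have "3 * card (V \<times> {0<..<k} - \<Union>D) \<le> e * card (V \<times> {0<..<k} - \<Union>D)"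
      using assms(2) by (rule mult_le_mono1)
    ultimately show "card (\<Union>(Q v) \<times> {0} \<union> V \<times> {0<..<k})
        \<le> e * card (V \<times> {0<..<k} - \<Union>D) + card (\<Union>D)"
      using cardD unfolding cardX N_def[symmetric] by linarith
  qed (use \<open>e > 0\<close> in auto)
  then obtain P0 where P0: "D \<subseteq> P0 v"
      "partition_on (\<Union>(Q v) \<times> {0} \<union> V \<times> {0<..<k}) (P0 v)"
      "\<forall>L\<in>P0 v. card L = e \<and> L \<inter> V \<times> {0<..<k} \<noteq> {}" if "v \<in> V" for v
    by metis
  have P0_meets: "card L = e \<and> L \<inter> V \<times> {0<..<k} \<noteq> {}" if "v \<in> V" "L \<in> P0 v" for v L
    using P0(3)[OF that(1)] that(2) by blast

  \<comment> \<open>Leaf sets in later copies for centres in copies of positive index\<close>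
  define A where "A = (\<lambda>v. {u\<in>V. C u \<noteq> C v})"
  \<comment> \<open>No leaf set is prescribed here, so the extension lemma is applied with the empty
    family; each block only has to contain a vertex coloured differently from
    \<open>v\<close>.\<close>
  have "\<exists>P. {} \<subseteq> P \<and> partition_on (V \<times> {i<..<k}) P \<and>
      (\<forall>L\<in>P. card L = e \<and> L \<inter> A v \<times> {i<..<k} \<noteq> {})" if v: "v \<in> V" for v i
  proof (rule partition_on_card_meeting_extend)
    have cardX: "card (V \<times> {i<..<k}) = n * (k - Suc i)"
      using n by (simp add: card_cartesian_product)
    then show "e dvd card (V \<times> {i<..<k})" using \<open>e dvd n\<close> by simp
    have "A v = V - colour_class V C (C v)"
      by (auto simp: A_def colour_class_def)
    moreover have "card (colour_class V C (C v)) = c"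
      using c Crange[OF v] by simp
    ultimately have "card (A v) = n - c"
      using fin n by (simp add: card_Diff_subset colour_class_def)
    \<comment> \<open>From \<open>2 * c \<le> n\<close> the difference \<open>n - c\<close> is at
      least half of \<open>n\<close>, so multiplying it by \<open>e \<ge> 3\<close> exceeds or
      equals \<open>n\<close>. The factor \<open>k - Suc i\<close> then counts the later
      copies.\<close>
    moreover have "n \<le> e * (n - c)"
      using \<open>2 * c \<le> n\<close> mult_le_mono1[OF assms(2), of "n - c"] by linarith
    then have "n * (k - Suc i) \<le> e * ((n - c) * (k - Suc i))"
      by (metis mult.assoc mult_le_mono1)
    ultimately show "card (V \<times> {i<..<k}) \<le> e * card (A v \<times> {i<..<k} - \<Union>{}) + card (\<Union>{})"
      unfolding cardX by (simp add: card_cartesian_product)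
  qed (use \<open>e > 0\<close> fin in \<open>auto simp: A_def\<close>)
  then obtain R where R: "partition_on (V \<times> {i<..<k}) (R v i)"
      "\<forall>L\<in>R v i. card L = e \<and> L \<inter> A v \<times> {i<..<k} \<noteq> {}" if "v \<in> V" for v i
    by metis
  have R_meets: "card L = e \<and> L \<inter> A v \<times> {i<..<k} \<noteq> {}" if "v \<in> V" "L \<in> R v i" for v i L
    using R(2)[OF that(1)] that(2) by blast

  \<comment> \<open>The star system of order n * k\<close>
  define W where "W = V \<times> {..<k}"
  define P where "P = (\<lambda>(v, i). if i = 0 then P0 v else image (\<lambda>x. (x, i)) ` Q v \<union> R v i)"
  define f where "f = (\<lambda>(v, i::nat). if i = 0 then k else C v)"
  \<comment> \<open>Although the groupings differ for \<open>i = 0\<close> and \<open>i > 0\<close>,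
    the out-neighbourhoods have one common form: those of \<open>v\<close> inside its own copy,
    together with all later copies.\<close>
  have UP: "\<Union>(P (v, i)) = \<Union>(Q v) \<times> {i} \<union> V \<times> {i<..<k}" if "v \<in> V" for v i
  proof (cases "i = 0")
    case True
    then show ?thesis using partition_onD1[OF P0(2)[OF that]] by (simp add: P_def)
  next
    case False
    then show ?thesis using partition_onD1[OF R(1)[OF that, of i]] by (auto simp: P_def)
  qed
  have cardP: "card L = e" if v: "v \<in> V" and L: "L \<in> P (v, i)" for v i L
  proof (cases "i = 0")
    case True
    then show ?thesis using P0_meets[OF v] L by (simp add: P_def)
  next
    case False
    then consider M where "M \<in> Q v" "L = (\<lambda>x. (x, i)) ` M" | "L \<in> R v i"
      using L by (auto simp: P_def)
    then show ?thesis
      using QL(1)[OF v] R_meets[OF v] by cases (auto simp: card_image inj_on_def)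
  qed
  have disjP: "disjoint (P (v, i))" if "v \<in> V" for v i
  proof (cases "i = 0")
    case True
    then show ?thesis using partition_onD2[OF P0(2)[OF that]] by (simp add: P_def)
  next
    case False
    have "disjoint (image (\<lambda>x. (x, i)) ` Q v \<union> R v i)"
    proof (rule disjoint_union)
      show "disjoint (image (\<lambda>x. (x, i)) ` Q v)"
        by (rule disjoint_image[OF _ Qv[OF that]]) (simp add: inj_on_def)
      show "disjoint (R v i)" using partition_onD2[OF R(1)[OF that]] .
      show "\<Union>(image (\<lambda>x. (x, i)) ` Q v) \<inter> \<Union>(R v i) = {}"
        unfolding partition_onD1[OF R(1)[OF that, of i], symmetric] by auto
    qed
    then show ?thesis using False by (simp add: P_def)
  qed
  have subP: "L \<subseteq> W - {(v, i)}" if "v \<in> V" "i < k" "L \<in> P (v, i)" for v i L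
  proof -
    have "L \<subseteq> \<Union>(Q v) \<times> {i} \<union> V \<times> {i<..<k}" using UP[OF that(1)] that(3) by blast
    also have "\<dots> \<subseteq> (V - {v}) \<times> {i} \<union> V \<times> {i<..<k}" using QL(2)[OF that(1)] by blast
    also have "\<dots> \<subseteq> W - {(v, i)}" using that(2) by (auto simp: W_def)
    finally show ?thesis .
  qed
  have orient: "star_orientation e W P"
    unfolding star_orientation_def
  proof (intro conjI ballI impI)
    fix p L assume p: "p \<in> W" "L \<in> P p"
    obtain v i where "p = (v, i)" "v \<in> V" "i < k" using p(1) by (auto simp: W_def)
    then show "card L = e" "L \<subseteq> W - {p}" using cardP subP p(2) by simp_all
  next
    fix p assume "p \<in> W"
    then show "disjoint (P p)" using disjP by (auto simp: W_def)
  next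
    fix p q assume pq: "p \<in> W" "q \<in> W" "p \<noteq> q"
    obtain u i v j where p: "p = (u, i)" and q: "q = (v, j)" by (cases p, cases q)
    have uv: "u \<in> V" "v \<in> V" "i < k" "j < k" using pq p q by (auto simp: W_def)
    \<comment> \<open>Between different copies the lower index is the tail; inside one copy the
      direction comes from \<open>Q\<close>.\<close>
    consider "i < j" | "j < i" | "i = j" "u \<noteq> v" using pq p q by force
    then show "(p \<in> \<Union>(P q)) \<noteq> (q \<in> \<Union>(P p))"
      unfolding p q UP[OF uv(1)] UP[OF uv(2)] using uv Q2[OF uv(1,2)] by cases auto
  qed
  have finW: "finite W" and cardW: "card W = n * k"
    using fin n by (simp_all add: W_def card_cartesian_product)
  have sysW: "star_system e (n * k) W (stars W P)"
    using star_system_stars[OF finW \<open>e > 0\<close> orient] cardW by simp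
  have colW: "is_colouring j W (stars W P) g \<longleftrightarrow>
      g \<in> W \<rightarrow> {1..j} \<and> (\<forall>p\<in>W. \<forall>L\<in>P p. \<exists>q\<in>L. g q \<noteq> g p)" for j g
  proof (rule is_colouring_stars)
    fix p L assume "p \<in> W" "L \<in> P p"
    then have "L \<subseteq> W - {p}" "card L = e"
      using orient unfolding star_orientation_def by blast+
    then show "L \<subseteq> W \<and> L \<noteq> {}" using \<open>e > 0\<close> by auto
  qed

  \<comment> \<open>The k-colouring\<close>
  have colf: "is_colouring k W (stars W P) f"
    unfolding colW
  proof (intro conjI ballI)
    show "f \<in> W \<rightarrow> {1..k}"
      using Crange assms(1) by (auto simp: W_def f_def less_imp_le)
    fix p L assume p: "p \<in> W" "L \<in> P p"
    obtain v i where vi: "p = (v, i)" "v \<in> V" using p(1) by (auto simp: W_def)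
    show "\<exists>q\<in>L. f q \<noteq> f p"
    proof (cases "i = 0")
      case True
      then have "L \<inter> V \<times> {0<..<k} \<noteq> {}" using P0_meets[OF vi(2)] p vi by (simp add: P_def)
      then obtain u j where "(u, j) \<in> L" "u \<in> V" "j > 0" by auto
      moreover from this have "f (u, j) \<noteq> f p"
        using Crange(2)[of u] by (simp add: f_def vi True)
      ultimately show ?thesis by blast
    next
      case False
      then consider M where "M \<in> Q v" "L = (\<lambda>x. (x, i)) ` M" | "L \<in> R v i"
        using p vi by (auto simp: P_def)
      then show ?thesis
      proof cases
        case 1
        then obtain u where "u \<in> M" "C u \<noteq> C v" using CQ[OF vi(2)] by blast
        then show ?thesis using 1 False vi by (auto simp: f_def)
      next
        case 2
        then obtain u j where "(u, j) \<in> L" "C u \<noteq> C v" "j > i"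
          using R_meets[OF vi(2)] by (fastforce simp: A_def)
        moreover from this have "f (u, j) \<noteq> f p" using False by (simp add: f_def vi)
        ultimately show ?thesis by blast
      qed
    qed
  qed

  \<comment> \<open>Impossibility of a (k - 1)-colouring\<close>
  have "\<not> colourable (k - 1) W (stars W P)"
  proof
    assume "colourable (k - 1) W (stars W P)"
    then obtain g where g: "g \<in> W \<rightarrow> {1..k - 1}"
      and gL: "\<And>p L. p \<in> W \<Longrightarrow> L \<in> P p \<Longrightarrow> \<exists>q\<in>L. g q \<noteq> g p"
      unfolding colourable_def colW by blast
    \<comment> \<open>Copy \<open>1\<close> has positive index, so all stars of \<open>B\<close>
      survive on it and the restriction of \<open>g\<close> colours \<open>B\<close>. Unique
      colourability makes this restriction agree with \<open>C\<close> up to a permutation.\<close>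
    have "is_colouring (k - 1) V B (\<lambda>v. g (v, 1))"
      unfolding colB
    proof (intro conjI ballI)
      show "(\<lambda>v. g (v, 1)) \<in> V \<rightarrow> {1..k - 1}" using g assms(1) by (auto simp: W_def)
      fix v L assume v: "v \<in> V" "L \<in> Q v"
      then have "(\<lambda>x. (x, 1)) ` L \<in> P (v, 1)" "(v, 1) \<in> W"
        using assms(1) by (auto simp: P_def W_def)
      then show "\<exists>u\<in>L. g (u, 1) \<noteq> g (v, 1)" using gL by blast
    qed
    then obtain p where p: "p permutes {1..k - 1}" "\<And>v. v \<in> V \<Longrightarrow> g (v, 1) = p (C v)"
      using assms(6,7) unfolding uniquely_colourable_def by blast
    have "n > 0" using \<open>c > e\<close> \<open>2 * c \<le> n\<close> by simp
    then obtain x where x: "x \<in> V" using n by fastforce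
    then have xW: "(x, 0) \<in> W" using assms(1) by (simp add: W_def)
    \<comment> \<open>As \<open>p\<close> is onto the \<open>k - 1\<close> colours, the colour of
      \<open>(x, 0)\<close> is the one that \<open>g\<close> gives to class \<open>a\<close> of copy
      \<open>1\<close> for some \<open>a\<close>. The star at \<open>(x, 0)\<close> with leaves
      \<open>T a \<times> {1}\<close> is then monochromatic.\<close>
    then have "g (x, 0) \<in> p ` {1..k - 1}" using g permutes_image[OF p(1)] by auto
    then obtain a where a: "a \<in> {1..k - 1}" "g (x, 0) = p a" by blast
    have "T a \<times> {1} \<in> P (x, 0)" using P0(1)[OF x] a by (auto simp: P_def D_def)
    from gL[OF xW this] obtain u where "u \<in> T a" "g (u, 1) \<noteq> g (x, 0)" by auto
    then show False using TC[of u a] p(2)[of u] a by auto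
  qed
  then have chrW: "chromatic k W (stars W P)"
    using colf by (auto simp: chromatic_def colourable_def)

  \<comment> \<open>Equality of the class sizes\<close>
  have "card (colour_class W f i) = n" if "i \<in> {1..k}" for i
  proof (cases "i = k")
    case True
    have "colour_class W f i = V \<times> {0}"
      using True Crange assms(1) by (fastforce simp: colour_class_def W_def f_def split: if_splits)
    then show ?thesis using n by (simp add: card_cartesian_product)
  next
    \<comment> \<open>An old class occurs once in each of the \<open>k - 1\<close> copies of
      positive index, and \<open>(k - 1) * c = n\<close> is the size of copy
      \<open>0\<close>.\<close>
    case False
    then have "colour_class W f i = colour_class V C i \<times> {0<..<k}"
      using that by (auto simp: colour_class_def W_def f_def split: if_splits)
    moreover have "card (colour_class V C i) = c" using c[of i] that False by auto
    ultimately show ?thesis using nc by (simp add: card_cartesian_product)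
  qed
  then have eqW: "strongly_equitable k W f"
    by (simp add: strongly_equitable_def)

  \<comment> \<open>Relabelling the vertices by natural numbers\<close>
  obtain h :: "'a \<times> nat \<Rightarrow> nat" where h: "inj_on h W"
    using finite_imp_inj_to_nat_seg[OF finW] by blast
  show ?thesis
  proof (intro exI conjI)
    show "star_system e (n * k) (h ` W) (image (image h) ` stars W P)"
      using star_system_image[OF h sysW] .
    show "[n * k = 0] (mod (2 * e))" using assms(4) by (simp add: cong_0_iff)
    show "chromatic k (h ` W) (image (image h) ` stars W P)"
      using chrW by (simp add: chromatic_def colourable_image[OF h sysW])
    show "is_colouring k (h ` W) (image (image h) ` stars W P) (f \<circ> inv_into W h)"
      using colf by (simp only: is_colouring_image[OF h sysW] colouring_inv_into_comp[OF h])
    show "strongly_equitable k (h ` W) (f \<circ> inv_into W h)"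
      using strongly_equitable_image[OF h eqW] .
  qed
qed

end
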